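(* Let $\alpha, x \in \mathbb{R}$ and let $n \ge 0$ be an integer. For each integer $m\ge 0$ put $$\beta_{m}=\sum_{i=0}^{m}\langle \alpha\rangle_{i}\,\frac{S(m,i)}{2^{i}}.$$ Then the higher-order Euler polynomial $E_n^{(\alpha)}(x)$ is given by the $(n+1)\times(n+1)$ determinant $$E_{n}^{(\alpha)}(x)=(-1)^{n}\begin{vmatrix} 1 & \beta_{0} & 0 & \cdots & 0 & 0\\ x & \beta_{1} & \beta_{0} & \cdots & 0 & 0\\ x^{2} & \beta_{2} & \binom{2}{1}\beta_{1} & \cdots & 0 & 0\\ \vdots & \vdots & \vdots & \ddots & \vdots & \vdots\\ x^{n-2} & \beta_{n-2} & \binom{n-2}{1}\beta_{n-3} & \cdots & \beta_{0} & 0\\ x^{n-1} & \beta_{n-1} & \binom{n-1}{1}\beta_{n-2} & \cdots & \binom{n-1}{n-2}\beta_{1} & \beta_{0}\\ x^{n} & \beta_{n} & \binom{n}{1}\beta_{n-1} & \cdots & \binom{n}{n-2}\beta_{2} & \binom{n}{n-1}\beta_{1} \end{vmatrix},$$ that is, the determinant of the matrix whose first column has entries $x^{r-1}$ ($1\le r\le n+1$) and whose $(c+1)$-st column, for $1\le c\le n$, has $r$-th entry $\binom{r-1}{c-1}\beta_{r-c}$ if $r\ge c$ and $0$ if $r<c$.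
   Context: The higher-order Euler polynomials $E_n^{(\alpha)}(x)$ are defined by the generating function $$\left(\frac{2}{e^{t}+1}\right)^{\alpha}e^{xt}=\sum_{n=0}^{\infty}E_n^{(\alpha)}(x)\frac{t^n}{n!}$$ for $t$ near $0$, where the power is the branch equal to $1$ at $t=0$. The falling factorial is $\langle y\rangle_0=1$ and $\langle y\rangle_m=y(y-1)\cdots(y-m+1)$ for $m\ge1$, $y\in\mathbb{R}$. $S(n,k)$ denotes the Stirling numbers of the second kind, defined by $\frac{(e^t-1)^k}{k!}=\sum_{n=k}^{\infty}S(n,k)\frac{t^n}{n!}$ (so $S(0,0)=1$ and $S(n,0)=0$ for $n\ge1$). The convention $x^0=1$ (also for $x=0$) is used. *)

theory Defs
  imports
    "HOL-Complex_Analysis.Complex_Analysis"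
    "HOL-Combinatorics.Stirling"
    "Jordan_Normal_Form.Determinant"
begin

definition falling_fact :: "real \<Rightarrow> nat \<Rightarrow> real" where
  "falling_fact y m = (\<Prod>i<m. y - real i)"

text \<open>The complex \<open>powr\<close> is taken with the principal logarithm; as the base equals
  \<open>1\<close> at \<open>t = 0\<close>, this is near \<open>0\<close> the holomorphic branch with value \<open>1\<close> at \<open>t = 0\<close>.\<close>

definition euler_gf :: "real \<Rightarrow> real \<Rightarrow> complex \<Rightarrow> complex" where
  "euler_gf \<alpha> x t = (2 / (exp t + 1)) powr of_real \<alpha> * exp (of_real x * t)"

text \<open>\<open>E\<close> is the sequence \<open>n \<mapsto> E\<^sub>n\<^sup>(\<^sup>\<alpha>\<^sup>)(x)\<close>; it exists and is unique by
  \<open>ex1_euler_poly_seq\<close> below.\<close>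

definition is_euler_poly_seq :: "real \<Rightarrow> real \<Rightarrow> (nat \<Rightarrow> real) \<Rightarrow> bool" where
  "is_euler_poly_seq \<alpha> x E \<longleftrightarrow>
     (\<forall>\<^sub>F t in nhds 0. (\<lambda>n. of_real (E n) * t ^ n / fact n) sums euler_gf \<alpha> x t)"

definition euler_poly :: "real \<Rightarrow> nat \<Rightarrow> real \<Rightarrow> real" where
  "euler_poly \<alpha> n x = (THE E. is_euler_poly_seq \<alpha> x E) n"

definition euler_beta :: "real \<Rightarrow> nat \<Rightarrow> real" where
  "euler_beta \<alpha> m = (\<Sum>i\<le>m. falling_fact \<alpha> i * real (Stirling m i) / 2 ^ i)"

text \<open>Rows and columns are indexed from \<open>0\<close>.\<close>

definition euler_matrix :: "real \<Rightarrow> real \<Rightarrow> nat \<Rightarrow> real mat" where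
  "euler_matrix \<alpha> x n = Matrix.mat (n + 1) (n + 1) (\<lambda>(r, c).
     if c = 0 then x ^ r
     else if c \<le> r + 1 then real (r choose (c - 1)) * euler_beta \<alpha> (r + 1 - c)
     else 0)"


subsection \<open>The generating functions determine the numbers they define\<close>

lemma sums_near_0_unique:
  fixes a b :: "nat \<Rightarrow> complex"
  assumes "\<forall>\<^sub>F t in nhds 0. (\<lambda>n. a n * t ^ n) sums f t"
    and "\<forall>\<^sub>F t in nhds 0. (\<lambda>n. b n * t ^ n) sums f t"
  shows "a = b"
proof -
  have expansion: "f has_fps_expansion Abs_fps u"
    if u: "\<forall>\<^sub>F t in nhds 0. (\<lambda>n. u n * t ^ n) sums f t" for u :: "nat \<Rightarrow> complex"
  proof -
    from u obtain d where d: "d > 0" "\<And>t. norm t < d \<Longrightarrow> (\<lambda>n. u n * t ^ n) sums f t"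
      by (auto simp: eventually_nhds_metric)
    have "summable (\<lambda>n. u n * of_real (d/2) ^ n)"
      using d(2)[of "of_real (d/2)"] d(1) by (auto simp: sums_iff)
    then have "conv_radius u \<ge> norm (of_real (d/2) :: complex)"
      by (rule conv_radius_geI)
    then have "fps_conv_radius (Abs_fps u) > 0"
      using d(1) by (simp add: fps_conv_radius_def)
        (metis ereal_less(2) half_gt_zero less_le_trans)
    moreover have "\<forall>\<^sub>F t in nhds 0. eval_fps (Abs_fps u) t = f t"
      using u by eventually_elim (auto simp: eval_fps_def sums_iff)
    ultimately show ?thesis
      by (simp add: has_fps_expansion_def)
  qed
  have "Abs_fps a = Abs_fps b"
    using expansion[OF assms(1)] expansion[OF assms(2)] by (rule fps_expansion_unique_complex)
  then show ?thesis
    by (simp add: Abs_fps_inject)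
qed

lemma euler_gf_analytic: "euler_gf \<alpha> x analytic_on {0}"
  unfolding euler_gf_def by (intro analytic_intros) auto

lemma euler_gf_cnj: "\<forall>\<^sub>F t in nhds 0. cnj (euler_gf \<alpha> x (cnj t)) = euler_gf \<alpha> x t"
proof -
  have "isCont (\<lambda>t::complex. Re (2 / (exp t + 1))) 0"
    by (intro isCont_Re continuous_intros) auto
  then have "((\<lambda>t::complex. Re (2 / (exp t + 1))) \<longlongrightarrow> 1) (nhds 0)"
    using tendsto_at_iff_tendsto_nhds[of "\<lambda>t::complex. Re (2 / (exp t + 1))" 0]
    by (simp add: isCont_def)
  then have "\<forall>\<^sub>F t::complex in nhds 0. Re (2 / (exp t + 1)) > 0"
    by (rule order_tendstoD) auto
  then show ?thesis
  proof eventually_elim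
    case (elim t)
    define w where "w = 2 / (exp t + 1)"
    have w: "w \<noteq> 0" "w \<notin> \<real>\<^sub>\<le>\<^sub>0"
      using elim by (auto simp: w_def complex_nonpos_Reals_iff)
    have "cnj (Ln (cnj w)) = Ln w"
      using cnj_Ln[OF w(2)] by (metis complex_cnj_cnj)
    then have "cnj (cnj w powr of_real \<alpha>) = w powr of_real \<alpha>"
      using w(1) by (simp add: powr_def exp_cnj)
    moreover have "2 / (exp (cnj t) + 1) = cnj w"
      by (simp add: w_def exp_cnj)
    ultimately show ?case
      by (simp only: euler_gf_def w_def[symmetric] complex_cnj_mult exp_cnj complex_cnj_cnj
          complex_cnj_complex_of_real)
  qed
qed

lemma ex1_euler_poly_seq: "\<exists>!E. is_euler_poly_seq \<alpha> x E"
proof (rule ex_ex1I)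
  obtain F where F: "euler_gf \<alpha> x has_fps_expansion F"
    using analytic_at_imp_has_fps_expansion_0[OF euler_gf_analytic] by blast
  define a where "a = fps_nth F"
  have a: "\<forall>\<^sub>F t in nhds 0. (\<lambda>n. a n * t ^ n) sums euler_gf \<alpha> x t"
  proof -
    have "\<forall>\<^sub>F t in nhds 0. t \<in> eball 0 (fps_conv_radius F)"
      using F by (intro eventually_nhds_in_open) (auto simp: has_fps_expansion_def zero_ereal_def)
    moreover have "\<forall>\<^sub>F t in nhds 0. eval_fps F t = euler_gf \<alpha> x t"
      using F by (simp add: has_fps_expansion_def)
    ultimately show ?thesis
      by eventually_elim (metis a_def in_eball_iff dist_0_norm sums_eval_fps)
  qed
  have "filterlim cnj (nhds 0) (nhds 0)"
    using tendsto_cnj[OF filterlim_ident, of 0] by simp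
  then have "\<forall>\<^sub>F t in nhds 0. (\<lambda>n. a n * cnj t ^ n) sums euler_gf \<alpha> x (cnj t)"
    using eventually_compose_filterlim[OF a] by blast
  with euler_gf_cnj[of \<alpha> x]
  have "\<forall>\<^sub>F t in nhds 0. (\<lambda>n. cnj (a n) * t ^ n) sums euler_gf \<alpha> x t"
  proof eventually_elim
    case (elim t)
    from elim(2) have "(\<lambda>n. cnj (a n * cnj t ^ n)) sums cnj (euler_gf \<alpha> x (cnj t))"
      by (simp only: sums_cnj)
    with elim(1) show ?case by simp
  qed
  from sums_near_0_unique[OF this a] have "of_real (Re (a n)) = a n" for n
    by (metis Reals_cnj_iff of_real_Re)
  then have "is_euler_poly_seq \<alpha> x (\<lambda>n. Re (a n) * fact n)"
    using a by (simp add: is_euler_poly_seq_def)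
  then show "\<exists>E. is_euler_poly_seq \<alpha> x E"
    by (rule exI[where x = "\<lambda>n. Re (a n) * fact n"])
next
  fix E E'
  assume "is_euler_poly_seq \<alpha> x E" and "is_euler_poly_seq \<alpha> x E'"
  then have "(\<lambda>n. complex_of_real (E n) / fact n) = (\<lambda>n. complex_of_real (E' n) / fact n)"
    by (intro sums_near_0_unique[of _ "euler_gf \<alpha> x"]) (simp_all add: is_euler_poly_seq_def)
  then show "E = E'"
    by (simp add: fun_eq_iff)
qed

lemma euler_poly_gf:
  "\<forall>\<^sub>F t in nhds 0. (\<lambda>n. of_real (euler_poly \<alpha> n x) * t ^ n / fact n) sums euler_gf \<alpha> x t"
  using theI'[OF ex1_euler_poly_seq[of \<alpha> x]]
  by (simp add: euler_poly_def is_euler_poly_seq_def)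

lemma Stirling_egf:
  "(fps_exp 1 - 1) ^ k = fps_const (fact k) * Abs_fps (\<lambda>n. of_nat (Stirling n k) / fact n :: real)"
proof -
  let ?e = "fps_exp 1 - 1 :: real fps"
  have "fps_nth (?e ^ k) n = fact k * of_nat (Stirling n k) / fact n" for n k
  proof (induction n arbitrary: k)
    case 0
    show ?case by (cases k) (auto simp: fps_nth_power_0)
  next
    case (Suc n)
    show ?case
    proof (cases k)
      case 0
      then show ?thesis by simp
    next
      case (Suc j)
      have "fps_deriv (?e ^ Suc j) = fps_const (of_nat (Suc j)) * (?e ^ Suc j + ?e ^ j)"
      proof -
        have "fps_deriv (?e ^ Suc j) = fps_const (of_nat (Suc j)) * (fps_deriv ?e * ?e ^ j)"
          by (simp only: fps_deriv_power mult.assoc diff_Suc_1)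
        also have "fps_deriv ?e * ?e ^ j = ?e ^ Suc j + ?e ^ j"
          by (simp add: algebra_simps)
        finally show ?thesis .
      qed
      then have "of_nat (Suc n) * fps_nth (?e ^ Suc j) (Suc n)
          = of_nat (Suc j) * (fps_nth (?e ^ Suc j) n + fps_nth (?e ^ j) n)"
        by (metis fps_add_nth fps_deriv_nth fps_mult_left_const_nth Suc_eq_plus1)
      also have "\<dots> = of_nat (Suc j) *
          (fact (Suc j) * of_nat (Stirling n (Suc j)) / fact n + fact j * of_nat (Stirling n j) / fact n)"
        by (simp only: Suc.IH)
      also have "\<dots> = fact (Suc j) * of_nat (Stirling (Suc n) (Suc j)) / fact n"
        by (simp add: field_simps)
      finally have "fps_nth (?e ^ Suc j) (Suc n)
          = fact (Suc j) * of_nat (Stirling (Suc n) (Suc j)) / fact n / of_nat (Suc n)"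
        by (metis nonzero_mult_div_cancel_left of_nat_neq_0)
      then show ?thesis
        by (simp only: Suc fact_Suc of_nat_mult divide_divide_eq_left mult.commute of_nat_id)
    qed
  qed
  then show ?thesis
    by (simp add: fps_eq_iff)
qed

end

theory Submission
  imports Defs
begin

text \<open>The numbers \<open>\<beta>\<^sub>m\<close> have the exponential generating function \<open>((e\<^sup>t + 1) / 2)\<^sup>\<alpha>\<close>: expand
  \<open>(1 + (e\<^sup>t - 1) / 2)\<^sup>\<alpha>\<close> by the binomial series. Multiplying by the generating function of the
  Euler polynomials leaves \<open>e\<^sup>x\<^sup>t\<close>, so \<open>x\<^sup>r = \<Sum>k\<le>r. (r choose k) \<beta>\<^sub>r\<^sub>-\<^sub>k E\<^sub>k\<close>, a unitriangular linear
  system for the \<open>E\<^sub>k\<close>. The determinant is then Cramer's rule for \<open>E\<^sub>n\<close>, up to the sign that comes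
  from moving the right-hand side from the last column to the first.\<close>

text \<open>Convergence at a single point \<open>z\<close> \<noteq> 0 of the disc already bounds the
  radius of convergence below by \<open>norm z\<close>.\<close>

lemma sums_imp_has_fps_expansion:
  fixes a :: "nat \<Rightarrow> complex"
  assumes "\<forall>\<^sub>F t in nhds 0. (\<lambda>n. a n * t ^ n) sums f t"
  shows "f has_fps_expansion Abs_fps a"
proof -
  from assms obtain d where d: "d > 0" "\<And>t. norm t < d \<Longrightarrow> (\<lambda>n. a n * t ^ n) sums f t"
    by (auto simp: eventually_nhds_metric)
  define z where "z = complex_of_real (d/2)"
  have z: "norm z < d" "norm z > 0"
    using d(1) by (simp_all add: z_def)
  then have "summable (\<lambda>n. a n * z ^ n)"
    using d(2) by (auto simp: sums_iff)
  then have "fps_conv_radius (Abs_fps a) \<ge> norm z"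
    by (simp add: fps_conv_radius_def conv_radius_geI)
  moreover have "ereal (norm z) > 0"
    using z by simp
  ultimately have "fps_conv_radius (Abs_fps a) > 0"
    by (rule order.strict_trans2[rotated])
  moreover have "\<forall>\<^sub>F t in nhds 0. eval_fps (Abs_fps a) t = f t"
    using assms by eventually_elim (auto simp: eval_fps_def sums_iff)
  ultimately show ?thesis
    by (simp add: has_fps_expansion_def)
qed

text \<open>Carries the real identity \<open>Stirling_egf\<close> over to complex power series,
  where the analytic expansions live.\<close>

lemma fps_exp_minus_1_power_nth_of_real:
  "fps_nth ((fps_exp 1 - 1) ^ k :: complex fps) n = of_real (fps_nth ((fps_exp 1 - 1) ^ k) n)"
proof (induction k arbitrary: n)
  case (Suc k)
  have "fps_nth (fps_exp 1 - 1 :: complex fps) m = of_real (fps_nth (fps_exp 1 - 1) m)" for m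
    by (cases m) simp_all
  with Suc show ?case
    by (simp only: power_Suc fps_mult_nth of_real_sum of_real_mult)
qed auto

lemma falling_fact_conv_gbinomial: "falling_fact y m = fact m * (y gchoose m)"
  by (simp add: falling_fact_def gbinomial_prod_rev atLeast0LessThan)

lemma gbinomial_of_real: "(complex_of_real a) gchoose k = of_real (a gchoose k)"
  by (simp add: gbinomial_prod_rev)

text \<open>The \<open>i\<close>-th term of the composition pairs \<open>\<alpha> gchoose i\<close>
  with \<open>fact i * Stirling m i / 2 ^ i / fact m\<close>; the factor \<open>fact i\<close> turns
  the binomial coefficient into \<open>falling_fact \<alpha> i\<close>.\<close>

lemma euler_beta_egf:
  "fps_binomial (of_real \<alpha>) oo (fps_const (1/2) * (fps_exp 1 - 1)) =
     Abs_fps (\<lambda>m. complex_of_real (euler_beta \<alpha> m / fact m))"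
proof (rule fps_ext)
  fix m
  have "fps_nth ((fps_const (1/2) * (fps_exp 1 - 1)) ^ i :: complex fps) m =
      of_real (fact i * Stirling m i / 2 ^ i / fact m)" for i
    by (simp add: power_mult_distrib fps_const_power fps_exp_minus_1_power_nth_of_real Stirling_egf
        power_divide)
  then show "fps_nth (fps_binomial (of_real \<alpha>) oo (fps_const (1/2) * (fps_exp 1 - 1))) m =
      fps_nth (Abs_fps (\<lambda>m. complex_of_real (euler_beta \<alpha> m / fact m))) m"
    by (simp add: fps_compose_nth euler_beta_def gbinomial_of_real falling_fact_conv_gbinomial
        sum_divide_distrib atMost_atLeast0 mult_ac)
qed

text \<open>Near 0 the base \<open>w\<close> is close to 1 and off the branch cut, so
  \<open>Ln (inverse w) = - Ln w\<close> and the two powers cancel. The base has the form 1 + z to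
  fit the binomial series.\<close>

lemma euler_gf_times_powr:
  "\<forall>\<^sub>F t in nhds 0. euler_gf \<alpha> x t * (1 + 1/2 * (exp t - 1)) powr of_real \<alpha> = exp (of_real x * t)"
proof -
  have "((\<lambda>t::complex. 1 + 1/2 * (exp t - 1)) \<longlongrightarrow> 1 + 1/2 * (exp 0 - 1)) (nhds 0)"
    by (intro tendsto_intros filterlim_ident)
  moreover have "open (- \<real>\<^sub>\<le>\<^sub>0 :: complex set)"
    by (simp add: open_Compl)
  ultimately have "\<forall>\<^sub>F t::complex in nhds 0. 1 + 1/2 * (exp t - 1) \<in> - \<real>\<^sub>\<le>\<^sub>0"
    by (rule topological_tendstoD) auto
  then show ?thesis
  proof eventually_elim
    case (elim t)
    define w where "w = 1 + 1/2 * (exp t - 1)"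
    have w: "w \<notin> \<real>\<^sub>\<le>\<^sub>0" "w \<noteq> 0"
      using elim by (auto simp: w_def)
    have "2 / (exp t + 1) = inverse w"
      by (simp add: w_def field_simps)
    moreover have "inverse w powr of_real \<alpha> * w powr of_real \<alpha> = 1"
      using w by (simp add: powr_def Ln_inverse flip: exp_add)
    ultimately show ?case
      by (simp only: euler_gf_def w_def[symmetric]) (simp add: mult_ac)
  qed
qed

lemma power_conv_euler_poly:
  "x ^ r = (\<Sum>k\<le>r. real (r choose k) * euler_beta \<alpha> (r - k) * euler_poly \<alpha> k x)"
proof -
  define E where "E = Abs_fps (\<lambda>n. complex_of_real (euler_poly \<alpha> n x / fact n))"
  define B where "B = Abs_fps (\<lambda>n. complex_of_real (euler_beta \<alpha> n / fact n))"
  have E: "euler_gf \<alpha> x has_fps_expansion E"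
    unfolding E_def using euler_poly_gf[of \<alpha> x]
    by (intro sums_imp_has_fps_expansion) simp
  have "(\<lambda>t::complex. 1/2 * (exp t - 1)) has_fps_expansion fps_const (1/2) * (fps_exp 1 - 1)"
    by (intro fps_expansion_intros)
  from has_fps_expansion_compose[OF has_fps_expansion_binomial_complex this, of "of_real \<alpha>"]
  have "(\<lambda>t. (1 + 1/2 * (exp t - 1)) powr of_real \<alpha>) has_fps_expansion B"
    by (simp add: o_def euler_beta_egf B_def)
  with E have "(\<lambda>t. euler_gf \<alpha> x t * (1 + 1/2 * (exp t - 1)) powr of_real \<alpha>) has_fps_expansion E * B"
    by (rule has_fps_expansion_mult)
  \<comment> \<open>An expansion at 0 depends only on the values near 0, so the local identity
    suffices.\<close>
  then have "(\<lambda>t. exp (of_real x * t)) has_fps_expansion E * B"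
    using has_fps_expansion_cong[OF euler_gf_times_powr refl] by blast
  then have "fps_exp (of_real x) = E * B"
    by (rule fps_expansion_unique_complex[OF has_fps_expansion_exp])
  then have "fps_nth (fps_exp (of_real x)) r = fps_nth (E * B) r"
    by simp
  then have "complex_of_real (x ^ r / fact r) =
      of_real (\<Sum>k\<le>r. euler_poly \<alpha> k x / fact k * (euler_beta \<alpha> (r - k) / fact (r - k)))"
    by (simp add: E_def B_def fps_mult_nth atMost_atLeast0)
  then have "x ^ r / fact r =
      (\<Sum>k\<le>r. euler_poly \<alpha> k x / fact k * (euler_beta \<alpha> (r - k) / fact (r - k)))"
    by (simp only: of_real_eq_iff)
  then have "x ^ r =
      (\<Sum>k\<le>r. fact r * (euler_poly \<alpha> k x / fact k * (euler_beta \<alpha> (r - k) / fact (r - k))))"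
    by (simp only: sum_distrib_left[symmetric]) (simp add: field_simps)
  also have "\<dots> = (\<Sum>k\<le>r. real (r choose k) * euler_beta \<alpha> (r - k) * euler_poly \<alpha> k x)"
    by (intro sum.cong refl) (simp add: binomial_fact mult_ac)
  finally show ?thesis .
qed

text \<open>Subtracting \<open>e k\<close> times column \<open>k\<close> of \<open>A\<close>, for \<open>k < n\<close>, from the first column leaves there
  only \<open>e n\<close> in the last entry.\<close>

lemma det_prepend_column_unitriangular:
  fixes A :: "nat \<Rightarrow> nat \<Rightarrow> 'a :: comm_ring_1"
  assumes upper: "\<And>r c. r < c \<Longrightarrow> A r c = 0"
    and diag: "\<And>r. A r r = 1"
    and b: "\<And>r. b r = (\<Sum>k\<le>r. A r k * e k)"
  shows "Determinant.det (Matrix.mat (Suc n) (Suc n) (\<lambda>(r, c). if c = 0 then b r else A r (c - 1)))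
    = (-1) ^ n * e n"
proof -
  define M where "M = Matrix.mat (Suc n) (Suc n) (\<lambda>(r, c). if c = 0 then b r else A r (c - 1))"
  \<comment> \<open>Right multiplication by \<open>L\<close> performs the column operation. Column
    \<open>i\<close> of \<open>M\<close> is column \<open>i - 1\<close> of \<open>A\<close>, hence
    the index of \<open>e\<close>.\<close>
  define L where "L = Matrix.mat (Suc n) (Suc n) (\<lambda>(i, j).
    if i = j then 1 else if j = 0 then - e (i - 1) else 0)"
  define N where "N = Matrix.mat (Suc n) (Suc n) (\<lambda>(r, c).
    if c = 0 then (if r = n then e n else 0) else A r (c - 1))"
  have M: "M \<in> carrier_mat (Suc n) (Suc n)" and L: "L \<in> carrier_mat (Suc n) (Suc n)"
    and N: "N \<in> carrier_mat (Suc n) (Suc n)"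
    by (simp_all add: M_def L_def N_def)
  have "M * L = N"
  proof (rule eq_matI)
    fix r c assume "r < dim_row N" "c < dim_col N"
    then have r: "r \<le> n" and c: "c \<le> n"
      by (simp_all add: N_def)
    have "(M * L) $$ (r, c) = (\<Sum>k\<le>n. M $$ (r, k) * L $$ (k, c))"
      using r c M L
      by (simp add: scalar_prod_def atLeast0LessThan lessThan_Suc_atMost)
    also have "\<dots> = N $$ (r, c)"
    proof (cases c)
      case 0
      \<comment> \<open>Entries of \<open>A\<close> right of the diagonal vanish, so
        \<open>b r\<close> is also the sum over all \<open>k\<close> \<le> \<open>n\<close>. Column
        \<open>n\<close> of \<open>A\<close> does not occur in \<open>M\<close>, so its term
        \<open>A r n * e n\<close> survives the subtraction.\<close>
      have "(\<Sum>k\<le>n. A r k * e k) = (\<Sum>k\<le>r. A r k * e k)"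
        using r by (intro sum.mono_neutral_right) (auto simp: upper not_le)
      moreover have "A r n = (if r = n then 1 else 0)"
        using r by (auto simp: diag upper)
      ultimately have "b r - (\<Sum>k<n. A r k * e k) = (if r = n then e n else 0)"
        by (auto simp: b algebra_simps simp flip: lessThan_Suc_atMost)
      moreover have "(\<Sum>k\<le>n. M $$ (r, k) * L $$ (k, c)) = b r - (\<Sum>k<n. A r k * e k)"
        using r 0 by (simp add: M_def L_def sum.atMost_shift sum_negf)
      ultimately show ?thesis
        using r 0 by (simp add: N_def)
    next
      case (Suc j)
      have "(\<Sum>k\<le>n. M $$ (r, k) * L $$ (k, c)) = (\<Sum>k\<le>n. if k = c then M $$ (r, k) else 0)"
        using c Suc by (intro sum.cong) (auto simp: L_def)
      then show ?thesis
        using r c Suc by (simp add: M_def N_def)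
    qed
    finally show "(M * L) $$ (r, c) = N $$ (r, c)" .
  qed (use M L N in auto)
  moreover have "Determinant.det L = 1"
    by (subst det_lower_triangular[OF _ L]) (auto simp: L_def prod_list_diag_prod)
  ultimately have "Determinant.det M = Determinant.det N"
    using det_mult[OF M L] by simp
  also have "\<dots> = (\<Sum>i<Suc n. N $$ (i, 0) * cofactor N i 0)"
    by (rule laplace_expansion_column[OF N]) simp
  also have "\<dots> = e n * cofactor N n 0"
    by (simp add: N_def)
  \<comment> \<open>The minor is the leading \<open>n\<close> by \<open>n\<close> block of
    \<open>A\<close>, with determinant 1; the sign comes from the position
    \<open>(n, 0)\<close>.\<close>
  also have "cofactor N n 0 = (-1) ^ n"
  proof -
    have "mat_delete N n 0 = Matrix.mat n n (\<lambda>(i, j). A i j)"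
      by (rule eq_matI) (auto simp: mat_delete_def N_def)
    moreover have "Determinant.det (Matrix.mat n n (\<lambda>(i, j). A i j)) = 1"
      by (subst det_lower_triangular[of n]) (auto simp: upper diag prod_list_diag_prod)
    ultimately show ?thesis
      by (simp add: cofactor_def)
  qed
  finally show ?thesis
    by (simp add: M_def mult.commute)
qed

theorem theorem4p3:
  fixes \<alpha> x :: real and n :: nat
  shows "euler_poly \<alpha> n x = (- 1) ^ n * Determinant.det (euler_matrix \<alpha> x n)"
proof -
  \<comment> \<open>For \<open>r < c\<close> the truncated \<open>r - c\<close> is 0, and the entry
    vanishes through its binomial coefficient.\<close>
  define A where "A r c = real (r choose c) * euler_beta \<alpha> (r - c)" for r c
  have "euler_matrix \<alpha> x n =
      Matrix.mat (Suc n) (Suc n) (\<lambda>(r, c). if c = 0 then x ^ r else A r (c - 1))"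
    unfolding euler_matrix_def by (rule eq_matI) (auto simp: A_def binomial_eq_0)
  moreover have "Determinant.det \<dots> = (-1) ^ n * euler_poly \<alpha> n x"
  proof (rule det_prepend_column_unitriangular)
    show "A r r = 1" for r
      by (simp add: A_def euler_beta_def falling_fact_def)
    show "x ^ r = (\<Sum>k\<le>r. A r k * euler_poly \<alpha> k x)" for r
      unfolding A_def by (rule power_conv_euler_poly)
  qed (simp add: A_def binomial_eq_0)
  ultimately show ?thesis
    by (simp flip: mult.assoc power_add mult_2)
qed

end
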